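(* Assume $\mathsf{CH}$ and let $\mathcal{I}$ be a proper ideal on $\omega$ containing all finite sets. Then there is a maximal eventually different family $\mathcal{F}\subseteq\omega^\omega$ such that $\mathcal{I}=\mathcal{I}_0(\mathcal{F})$.
   Context: Functions $f,g$ with common domain $A\subseteq\omega$ are eventually different if they agree on only finitely many points of $A$; an eventually different (e.d.) family is one whose distinct members are pairwise eventually different; it is maximal (m.e.d.) if maximal under inclusion among e.d. families of functions $A\to\omega$. For $\mathcal{F}\subseteq\omega^\omega$ and infinite $A\subseteq\omega$ let $\mathcal{F}\restriction A=\{f\restriction A: f\in\mathcal{F}\}$. $\mathcal{I}_0(\mathcal{F}) := \{A\subseteq\omega \text{ infinite} : \mathcal{F}\restriction A \text{ is not a m.e.d. family of functions } A\to\omega\}\cup\mathrm{Fin}$, where $\mathrm{Fin}$ is the set of finite subsets of $\omega$. *)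

theory Defs
  imports "HOL-Library.FuncSet"
begin

unbundle cardinal_syntax

definition continuum_hypothesis :: bool where
  "continuum_hypothesis \<longleftrightarrow> |UNIV :: nat set set| =o cardSuc natLeq"

definition proper_ideal :: "'a set set \<Rightarrow> bool" where
  "proper_ideal I \<longleftrightarrow>
     {} \<in> I \<and> (\<forall>A\<in>I. \<forall>B. B \<subseteq> A \<longrightarrow> B \<in> I) \<and> (\<forall>A\<in>I. \<forall>B\<in>I. A \<union> B \<in> I) \<and> UNIV \<notin> I"

definition eventually_different_on :: "nat set \<Rightarrow> (nat \<Rightarrow> nat) \<Rightarrow> (nat \<Rightarrow> nat) \<Rightarrow> bool" where
  "eventually_different_on A f g \<longleftrightarrow> finite {n \<in> A. f n = g n}"

(* Functions A -> omega are represented extensionally, i.e. with value undefined outside A, so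
   that equality in A \<rightarrow>\<^sub>E UNIV is equality of functions on A.
   For A = UNIV this is the full type nat \<Rightarrow> nat. *)
definition ed_family :: "nat set \<Rightarrow> (nat \<Rightarrow> nat) set \<Rightarrow> bool" where
  "ed_family A F \<longleftrightarrow> F \<subseteq> (A \<rightarrow>\<^sub>E UNIV) \<and> pairwise (eventually_different_on A) F"

definition med_family :: "nat set \<Rightarrow> (nat \<Rightarrow> nat) set \<Rightarrow> bool" where
  "med_family A F \<longleftrightarrow> ed_family A F \<and> (\<forall>G. ed_family A G \<and> F \<subseteq> G \<longrightarrow> G = F)"

definition restrict_family :: "(nat \<Rightarrow> nat) set \<Rightarrow> nat set \<Rightarrow> (nat \<Rightarrow> nat) set" where
  "restrict_family F A = (\<lambda>f. restrict f A) ` F"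

definition I0 :: "(nat \<Rightarrow> nat) set \<Rightarrow> nat set set" where
  "I0 F = {A. infinite A \<and> \<not> med_family A (restrict_family F A)} \<union> {A. finite A}"

end

theory Submission
  imports Defs "HOL-Library.Countable_Set_Type" "HOL-Library.Nat_Bijection"
begin

text \<open>
  By CH, the pairs \<open>(A, g)\<close> with \<open>A \<subseteq> \<omega>\<close> and \<open>g : \<omega> \<rightarrow> \<omega>\<close> are well-ordered with countable initial
  segments. By recursion each pair \<open>t = (A, g)\<close> receives a function \<open>K t\<close>. If \<open>A \<in> I\<close>, then \<open>K t\<close> is a
  promise: it has to stay eventually different on \<open>A\<close> from the whole family, so that \<open>A \<in> I\<^sub>0(F)\<close>.
  If \<open>A \<notin> I\<close>, then \<open>K t\<close> joins the family \<open>F\<close>, and it agrees with \<open>g\<close> infinitely often on \<open>A\<close> unless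
  an earlier member does. The latter is compatible with the countably many promises made so far:
  \<open>A\<close> is not covered by finitely many sets in \<open>I\<close>, hence it has an infinite subset almost disjoint
  from all the domains of earlier promises, and on it \<open>K t\<close> may copy \<open>g\<close>.
\<close>

section \<open>Almost disjoint subsets and diagonal functions\<close>

text \<open>Diagonal choice: \<open>b m\<close> avoids the first \<open>m + 1\<close> sets, so only
  the \<open>b m\<close> with \<open>m < i\<close> can lie in \<open>E i\<close>, while
  \<open>b m \<ge> m\<close> makes the range infinite.\<close>

lemma infinite_pseudo_intersection:
  fixes A :: "nat set" and E :: "nat \<Rightarrow> nat set"
  assumes "\<And>m. infinite (A - (\<Union>i\<le>m. E i))"
  shows "\<exists>B\<subseteq>A. infinite B \<and> (\<forall>i. finite (B \<inter> E i))"
proof -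
  have "\<forall>m. \<exists>b. b \<ge> m \<and> b \<in> A - (\<Union>i\<le>m. E i)"
    using assms by (meson infinite_nat_iff_unbounded_le)
  then obtain b where b: "\<And>m. b m \<ge> m" "\<And>m. b m \<in> A - (\<Union>i\<le>m. E i)"
    by metis
  have "infinite (range b)"
    unfolding infinite_nat_iff_unbounded_le using b(1) by blast
  moreover have "finite (range b \<inter> E i)" for i
  proof (rule finite_subset)
    show "range b \<inter> E i \<subseteq> b ` {..<i}"
      using b(2) by (force simp: not_le[symmetric])
  qed simp
  ultimately show ?thesis
    using b(2) by (intro exI[of _ "range b"]) auto
qed

lemma proper_ideal_finite_UN:
  assumes "proper_ideal I" "finite T" "\<And>t. t \<in> T \<Longrightarrow> E t \<in> I"
  shows "(\<Union>t\<in>T. E t) \<in> I"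
  using assms(2,3) by (induction T) (use assms(1) in \<open>auto simp: proper_ideal_def\<close>)

text \<open>Finitely many \<open>E s\<close> cover only a part of \<open>A\<close> that is in
  \<open>I\<close>; the rest is outside \<open>I\<close>, hence infinite, and the diagonal choice
  applies.\<close>

lemma ideal_positive_pseudo_intersection:
  fixes I :: "nat set set"
  assumes I: "proper_ideal I" "\<And>A. finite A \<Longrightarrow> A \<in> I"
    and "A \<notin> I" "countable S" and E: "\<And>s. s \<in> S \<Longrightarrow> A \<inter> E s \<in> I"
  shows "\<exists>B\<subseteq>A. infinite B \<and> (\<forall>s\<in>S. finite (B \<inter> E s))"
\<comment> \<open>\<open>from_nat_into\<close> enumerates nonempty sets only; for empty
  \<open>S\<close> take \<open>B = A\<close>.\<close>
proof (cases "S = {}")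
  case True
  then show ?thesis using I(2) \<open>A \<notin> I\<close> by blast
next
  case False
  let ?e = "from_nat_into S"
  have "infinite (A - (\<Union>i\<le>m. E (?e i)))" for m
  proof
    assume "finite (A - (\<Union>i\<le>m. E (?e i)))"
    moreover have "(\<Union>i\<le>m. A \<inter> E (?e i)) \<in> I"
      by (rule proper_ideal_finite_UN[OF I(1)]) (simp_all add: E from_nat_into False)
    ultimately have "(A - (\<Union>i\<le>m. E (?e i))) \<union> (\<Union>i\<le>m. A \<inter> E (?e i)) \<in> I"
      using I unfolding proper_ideal_def by blast
    moreover have "(A - (\<Union>i\<le>m. E (?e i))) \<union> (\<Union>i\<le>m. A \<inter> E (?e i)) = A"
      by blast
    ultimately show False using \<open>A \<notin> I\<close> by simp
  qed
  from infinite_pseudo_intersection[OF this]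
  obtain B where "B \<subseteq> A" "infinite B" and B: "\<forall>i. finite (B \<inter> E (?e i))"
    by blast
  moreover have "finite (B \<inter> E s)" if "s \<in> S" for s
    using B from_nat_into_to_nat_on[OF \<open>countable S\<close> that] by metis
  ultimately show ?thesis by blast
qed

text \<open>On \<open>B\<close> the function copies \<open>g\<close>. Off \<open>B\<close> it
  exceeds at \<open>n\<close> the first \<open>n + 1\<close> functions of an enumeration, so there
  it can agree with \<open>k s\<close> only below an index of \<open>s\<close>.\<close>

lemma eventually_different_extension:
  fixes k :: "'a \<Rightarrow> nat \<Rightarrow> nat"
  assumes "countable S" and B: "\<And>s. s \<in> S \<Longrightarrow> eventually_different_on (B \<inter> D s) g (k s)"
  shows "\<exists>f. (\<forall>n\<in>B. f n = g n) \<and> (\<forall>s\<in>S. eventually_different_on (D s) f (k s))"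
proof -
  define f where "f n = (if n \<in> B then g n else Suc (\<Sum>i\<le>n. k (from_nat_into S i) n))" for n
  have "eventually_different_on (D s) f (k s)" if "s \<in> S" for s
  proof -
    obtain i where i: "from_nat_into S i = s"
      using from_nat_into_surj[OF \<open>countable S\<close> \<open>s \<in> S\<close>] by blast
    have neq: "f n \<noteq> k s n" if "n \<notin> B" "i \<le> n" for n
    proof -
      have "k s n \<le> (\<Sum>i\<le>n. k (from_nat_into S i) n)"
        using member_le_sum[of i "{..n}" "\<lambda>i. k (from_nat_into S i) n"] that i by simp
      then show ?thesis using that by (simp add: f_def)
    qed
    have "{n \<in> D s. f n = k s n} \<subseteq> {n \<in> B \<inter> D s. g n = k s n} \<union> {..<i}"
      using neq by (auto simp: f_def not_less[symmetric])
    then show ?thesis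
      using B[OF \<open>s \<in> S\<close>] unfolding eventually_different_on_def
      by (meson finite_UnI finite_lessThan finite_subset)
  qed
  then show ?thesis by (intro exI[of _ f]) (simp add: f_def)
qed

section \<open>Maximality on a restricted domain\<close>

text \<open>A \<open>g\<close> eventually different on \<open>A\<close> from all of \<open>F\<close>
  could be added; conversely, a member of a larger family meets some \<open>f\<close> infinitely
  often, hence equals its restriction. As only values on \<open>A\<close> matter, \<open>g\<close>
  may range over total functions.\<close>

lemma med_family_restrict_iff:
  assumes F: "ed_family UNIV F" and "infinite A"
  shows "med_family A (restrict_family F A) \<longleftrightarrow>
    (\<forall>g. \<exists>f\<in>F. \<not> eventually_different_on A f g)"
proof
  have edF: "ed_family A (restrict_family F A)"
    unfolding ed_family_def pairwise_def
  proof (intro conjI ballI impI)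
    show "restrict_family F A \<subseteq> A \<rightarrow>\<^sub>E UNIV"
      by (auto simp: restrict_family_def)
    fix u v assume "u \<in> restrict_family F A" "v \<in> restrict_family F A" "u \<noteq> v"
    then obtain f g where fg: "f \<in> F" "g \<in> F" "f \<noteq> g" "u = restrict f A" "v = restrict g A"
      unfolding restrict_family_def by blast
    then have "finite {n. f n = g n}"
      using F by (auto simp: ed_family_def pairwise_def eventually_different_on_def)
    then show "eventually_different_on A u v"
      unfolding eventually_different_on_def fg
      by (rule rev_finite_subset) auto
  qed
  show "\<forall>g. \<exists>f\<in>F. \<not> eventually_different_on A f g" if med: "med_family A (restrict_family F A)"
  proof (rule ccontr)
    assume "\<not> ?thesis"
    then obtain g where g: "\<And>f. f \<in> F \<Longrightarrow> finite {n \<in> A. f n = g n}"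
      unfolding eventually_different_on_def by blast
    let ?h = "restrict g A"
    have h: "finite {n \<in> A. u n = ?h n}" if "u \<in> restrict_family F A" for u
    proof -
      obtain f where f: "f \<in> F" "u = restrict f A"
        using \<open>u \<in> _\<close> unfolding restrict_family_def by blast
      show ?thesis by (rule rev_finite_subset[OF g[OF f(1)]]) (auto simp: f(2))
    qed
    moreover from this have "finite {n \<in> A. ?h n = u n}" if "u \<in> restrict_family F A" for u
      using that by (simp add: eq_commute)
    ultimately have "ed_family A (insert ?h (restrict_family F A))"
      using edF by (auto simp: ed_family_def pairwise_insert eventually_different_on_def)
    then have "insert ?h (restrict_family F A) = restrict_family F A"
      using med unfolding med_family_def by blast
    then have "?h \<in> restrict_family F A" by blast
    \<comment> \<open>\<open>?h\<close> agrees with itself on all of \<open>A\<close>, so it was not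
      yet a member.\<close>
    from h[OF this] show False using \<open>infinite A\<close> by simp
  qed
  show "med_family A (restrict_family F A)" if max: "\<forall>g. \<exists>f\<in>F. \<not> eventually_different_on A f g"
    unfolding med_family_def
  proof (intro conjI allI impI edF)
    fix G assume G: "ed_family A G \<and> restrict_family F A \<subseteq> G"
    have "g \<in> restrict_family F A" if "g \<in> G" for g
    proof -
      obtain f where f: "f \<in> F" "\<not> eventually_different_on A f g"
        using max by blast
      have "{n \<in> A. restrict f A n = g n} = {n \<in> A. f n = g n}" by auto
      with f(2) have "\<not> eventually_different_on A (restrict f A) g"
        by (simp add: eventually_different_on_def)
      moreover have fA: "restrict f A \<in> restrict_family F A"
        using f(1) by (simp add: restrict_family_def)
      ultimately have "restrict f A = g"
        using G that unfolding ed_family_def pairwise_def by blast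
      with fA show ?thesis by simp
    qed
    with G show "G = restrict_family F A" by blast
  qed
qed

section \<open>A well-order of the pairs with countable initial segments\<close>

text \<open>Column 0 of the coded set stores \<open>A\<close>, and column \<open>n + 1\<close>
  stores \<open>g n\<close>. Through this code the pairs inherit a well-order from the sets of
  naturals.\<close>

lemma inj_nat_set_times_nat_fun:
  "inj (\<lambda>(A, g :: nat \<Rightarrow> nat). prod_encode ` (Pair 0 ` A \<union> range (\<lambda>n. (Suc n, g n))))"
proof (rule injI, clarify)
  fix A A' :: "nat set" and g g' :: "nat \<Rightarrow> nat"
  let ?S = "\<lambda>A g. Pair 0 ` A \<union> range (\<lambda>n. (Suc n, g n :: nat))"
  assume "prod_encode ` ?S A g = prod_encode ` ?S A' g'"
  then have eq: "?S A g = ?S A' g'"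
    by (metis inj_image_eq_iff inj_prod_encode)
  have "A = {a. (0, a) \<in> ?S A g}" for A and g :: "nat \<Rightarrow> nat" by auto
  with eq have "A = A'" by metis
  moreover have "g n = g' n" for n
  proof -
    have "(Suc n, g n) \<in> ?S A' g'" using eq by blast
    then show ?thesis by auto
  qed
  ultimately show "A = A' \<and> g = g'" by blast
qed

text \<open>Proper initial segments of a cardinal order are strictly smaller than its field, so
  countable under CH. Pulling its strict part back along the injection \<open>\<phi>\<close>
  preserves totality and countability.\<close>

lemma continuum_hypothesis_wellorder:
  assumes continuum_hypothesis and \<phi>: "inj (\<phi> :: 'a \<Rightarrow> nat set)"
  shows "\<exists>R :: 'a rel. wf R \<and> total R \<and> (\<forall>t. countable {s. (s, t) \<in> R})"
proof -
  define r where "r = |UNIV :: nat set set|"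
  have Field: "Field r = UNIV"
    by (simp add: r_def Field_card_of)
  have co: "Card_order r" and wo: "Well_order r"
    unfolding r_def by (rule card_of_Card_order card_of_Well_order)+
  have countable: "countable (underS r a)" for a
  proof -
    have "|underS r a| <o r"
      using card_of_underS[OF co] Field by simp
    then have "|underS r a| <o cardSuc natLeq"
      using assms(1) unfolding continuum_hypothesis_def r_def by (rule ordLess_ordIso_trans)
    then have "|underS r a| \<le>o natLeq"
      using cardSuc_ordLeq_ordLess[OF natLeq_Card_order card_of_Card_order] by blast
    then show ?thesis by (simp add: countable_card_le_natLeq)
  qed
  define R where "R = inv_image (r - Id) \<phi>"
  have "wf R"
    using wo by (simp add: R_def wf_inv_image well_order_on_def)
  moreover have "total R"
    using wo \<phi> Field
    by (auto simp: R_def total_on_def well_order_on_def linear_order_on_def inj_eq)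
  moreover have "countable {s. (s, t) \<in> R}" for t
  proof -
    have "\<phi> ` {s. (s, t) \<in> R} \<subseteq> underS r (\<phi> t)"
      by (auto simp: R_def underS_def)
    then have "countable (\<phi> ` {s. (s, t) \<in> R})"
      using countable countable_subset by blast
    then show ?thesis
      using countable_image_inj_on inj_on_subset[OF \<phi>] by blast
  qed
  ultimately show ?thesis by blast
qed

section \<open>The recursion\<close>

text \<open>\<open>D s\<close> is where later functions must avoid \<open>K s\<close>: the domain of
  a promise, but all of \<omega> for a member. Each stage faces only countably many such
  requirements.\<close>

lemma eventually_different_recursion:
  fixes I :: "nat set set" and R :: "(nat set \<times> (nat \<Rightarrow> nat)) rel"
  assumes I: "proper_ideal I" "\<And>A. finite A \<Longrightarrow> A \<in> I"
    and R: "wf R" "\<And>t. countable {s. (s, t) \<in> R}"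
  defines "D \<equiv> \<lambda>s :: nat set \<times> (nat \<Rightarrow> nat). if fst s \<in> I then fst s else UNIV"
  shows "\<exists>K. \<forall>t. (\<forall>s. (s, t) \<in> R \<longrightarrow> eventually_different_on (D s) (K t) (K s)) \<and>
    (fst t \<notin> I \<longrightarrow> (\<exists>s. fst s \<notin> I \<and> \<not> eventually_different_on (fst t) (K s) (snd t)))"
proof -
  \<comment> \<open>Only values of \<open>K\<close> before \<open>t\<close> enter, as
    \<open>dependent_wf_choice\<close> demands; \<open>y\<close> is the candidate for
    \<open>K t\<close>.\<close>
  define P where "P K t y \<longleftrightarrow>
    (\<forall>s. (s, t) \<in> R \<longrightarrow> eventually_different_on (D s) y (K s)) \<and>
    (fst t \<notin> I \<longrightarrow> \<not> eventually_different_on (fst t) y (snd t) \<or>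
      (\<exists>s. (s, t) \<in> R \<and> fst s \<notin> I \<and> \<not> eventually_different_on (fst t) (K s) (snd t)))"
    for K t y
  have "\<exists>K. \<forall>t. P K t (K t)"
  proof (rule dependent_wf_choice[OF R(1)])
    show "P K t y = P K' t y" if "\<And>s. (s, t) \<in> R \<Longrightarrow> K s = K' s" for K K' t y
      unfolding P_def by (metis that)
  next
    fix t :: "nat set \<times> (nat \<Rightarrow> nat)" and K :: "nat set \<times> (nat \<Rightarrow> nat) \<Rightarrow> nat \<Rightarrow> nat"
    obtain A g where t: "t = (A, g)" by fastforce
    let ?S = "{s. (s, t) \<in> R}"
    show "\<exists>y. P K t y"
    proof (cases "A \<notin> I \<and> (\<forall>s\<in>?S. fst s \<notin> I \<longrightarrow> eventually_different_on A (K s) g)")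
      case True
      \<comment> \<open>Copying \<open>g\<close> violates the requirement of \<open>s\<close>
        exactly at these points. Within \<open>A\<close> they lie in the promised domain or, for a
        member, are finitely many by the case assumption.\<close>
      let ?E = "\<lambda>s. {n \<in> D s. g n = K s n}"
      have "A \<inter> ?E s \<in> I" if "s \<in> ?S" for s
      proof (cases "fst s \<in> I")
        case True
        moreover have "A \<inter> ?E s \<subseteq> fst s"
          using True by (auto simp: D_def)
        ultimately show ?thesis
          using I(1) unfolding proper_ideal_def by blast
      next
        case False
        then have "finite {n \<in> A. K s n = g n}"
          using \<open>A \<notin> I \<and> _\<close> that unfolding eventually_different_on_def by blast
        moreover have "A \<inter> ?E s = {n \<in> A. K s n = g n}"
          using False by (auto simp: D_def)
        ultimately show ?thesis using I(2) by simp
      qed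
      then obtain B where "B \<subseteq> A" "infinite B" and B: "\<forall>s\<in>?S. finite (B \<inter> ?E s)"
        using ideal_positive_pseudo_intersection[OF I _ R(2), of A t ?E] True by blast
      have "eventually_different_on (B \<inter> D s) g (K s)" if "s \<in> ?S" for s
      proof -
        have "{n \<in> B \<inter> D s. g n = K s n} = B \<inter> ?E s" by blast
        then show ?thesis
          using bspec[OF B that] unfolding eventually_different_on_def by (rule ssubst)
      qed
      from eventually_different_extension[of ?S B D g K, OF R(2) this]
      obtain y where y: "\<forall>n\<in>B. y n = g n" "\<forall>s\<in>?S. eventually_different_on (D s) y (K s)"
        by blast
      have "B \<subseteq> {n \<in> A. y n = g n}"
        using \<open>B \<subseteq> A\<close> y(1) by blast
      then have "\<not> eventually_different_on A y g"
        using \<open>infinite B\<close> finite_subset unfolding eventually_different_on_def by blast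
      with y(2) show ?thesis by (auto simp: P_def t)
    next
      case False
      \<comment> \<open>Here \<open>t\<close> is a promise or an earlier member already meets
        \<open>g\<close>, so nothing is copied: \<open>B\<close> is empty.\<close>
      from eventually_different_extension[of ?S "{}" D g K, OF R(2)]
      obtain y where "\<forall>s\<in>?S. eventually_different_on (D s) y (K s)"
        by (auto simp: eventually_different_on_def)
      with False show ?thesis by (auto simp: P_def t)
    qed
  qed
  then obtain K where K: "\<And>t. P K t (K t)" by blast
  show ?thesis
    using K unfolding P_def by (intro exI[of _ K]) blast
qed

section \<open>The family of members and its ideal\<close>

theorem theorem5p6:
  fixes I :: "nat set set"
  assumes "continuum_hypothesis"
    and "proper_ideal I"
    and "\<And>A. finite A \<Longrightarrow> A \<in> I"
  shows "\<exists>F :: (nat \<Rightarrow> nat) set. med_family UNIV F \<and> I = I0 F"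
proof -
  note I = assms(2,3)
  from continuum_hypothesis_wellorder[OF assms(1) inj_nat_set_times_nat_fun]
  obtain R :: "(nat set \<times> (nat \<Rightarrow> nat)) rel"
    where R: "wf R" "\<And>t. countable {s. (s, t) \<in> R}" and "total R"
    by blast
  from eventually_different_recursion[OF I R]
  obtain K where
    ed: "\<And>s t. (s, t) \<in> R \<Longrightarrow>
      eventually_different_on (if fst s \<in> I then fst s else UNIV) (K t) (K s)"
    and meets: "\<And>t. fst t \<notin> I \<Longrightarrow>
      \<exists>s. fst s \<notin> I \<and> \<not> eventually_different_on (fst t) (K s) (snd t)"
    by blast
  have sym: "eventually_different_on A f g = eventually_different_on A g f" for A f g
    by (simp add: eventually_different_on_def eq_commute)
  have mono: "eventually_different_on A f g" if "eventually_different_on UNIV f g" for A f g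
    using that unfolding eventually_different_on_def by (auto elim: rev_finite_subset)
  define F where "F = K ` {t. fst t \<notin> I}"
  have F: "ed_family UNIV F"
    unfolding ed_family_def pairwise_def
  proof (intro conjI ballI impI)
    fix f g assume "f \<in> F" "g \<in> F" "f \<noteq> g"
    then obtain s t where st: "f = K s" "g = K t" "fst s \<notin> I" "fst t \<notin> I" "s \<noteq> t"
      unfolding F_def by blast
    then have "(s, t) \<in> R \<or> (t, s) \<in> R"
      using \<open>total R\<close> unfolding total_on_def by blast
    then show "eventually_different_on UNIV f g"
      using ed[of s t] ed[of t s] st sym by auto
  qed auto
  \<comment> \<open>Both claims follow from this: \<open>A = UNIV\<close> gives maximality of
    \<open>F\<close>, and all infinite \<open>A\<close> together give
    \<open>I = I0 F\<close>.\<close>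
  have med: "med_family A (restrict_family F A) \<longleftrightarrow> A \<notin> I" if "infinite A" for A
    unfolding med_family_restrict_iff[OF F that]
  proof
    assume "A \<notin> I"
    then show "\<forall>g. \<exists>f\<in>F. \<not> eventually_different_on A f g"
      using meets[of "(A, _)"] unfolding F_def by auto
  next
    assume max: "\<forall>g. \<exists>f\<in>F. \<not> eventually_different_on A f g"
    show "A \<notin> I"
    proof
      assume "A \<in> I"
      \<comment> \<open>The second component is arbitrary. The promise \<open>K ?t\<close> differs
        eventually from earlier members everywhere, and later members differ eventually from it on
        \<open>A\<close>.\<close>
      let ?t = "(A, \<lambda>_. 0)"
      obtain s where s: "fst s \<notin> I" "\<not> eventually_different_on A (K s) (K ?t)"
        using max unfolding F_def by blast
      then have "(s, ?t) \<in> R \<or> (?t, s) \<in> R"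
        using \<open>total R\<close> \<open>A \<in> I\<close> unfolding total_on_def by (metis UNIV_I fst_conv)
      then show False
        using ed[of s ?t] ed[of ?t s] s \<open>A \<in> I\<close> sym mono by auto
    qed
  qed
  have "infinite (UNIV :: nat set)" and "UNIV \<notin> I"
    using I(1) by (simp_all add: proper_ideal_def)
  moreover have "restrict_family F UNIV = F"
    by (simp add: restrict_family_def restrict_UNIV)
  ultimately have "med_family UNIV F"
    using med[of UNIV] by simp
  moreover have "I = I0 F"
    using med I(2) by (auto simp: I0_def)
  ultimately show ?thesis by blast
qed

end
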